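(* Let $\mathcal H$ be a real Hilbert space, let $\mu\in\,]0,\infty[$, let $n\ge 1$ be an integer, $I=\{1,\dots,n\}$, and let $\lambda_i>0$ ($i\in I$) satisfy $\sum_{i\in I}\lambda_i=1$. For each $i\in I$ let $A_i:\mathcal H\rightrightarrows\mathcal H$ be maximally monotone, and write $\mathbf A=(A_1,\dots,A_n)$, $\boldsymbol\lambda=(\lambda_1,\dots,\lambda_n)$. If there exists $i_0\in I$ such that $A_{i_0}$ is strictly monotone, then $\mathcal R_\mu(\mathbf A,\boldsymbol\lambda)$ is strictly monotone.
   Context: A mapping $A:\mathcal H\rightrightarrows\mathcal H$ is strictly monotone if whenever $u\in Ax$ and $v\in Ay$ with $x\neq y$, then $0<\langle u-v,x-y\rangle$. $A^{-1}$ is the set-valued mapping with $x\in A^{-1}u\Leftrightarrow u\in Ax$. Sums and scalar multiples of set-valued mappings are pointwise Minkowski operations; $\mathrm{Id}$ is the identity. The $\boldsymbol\lambda$-weighted resolvent average of $\mathbf A$ with parameter $\mu$ is the set-valued mapping $$\mathcal R_\mu(\mathbf A,\boldsymbol\lambda)=\Big(\sum_{i\in I}\lambda_i(A_i+\mu^{-1}\mathrm{Id})^{-1}\Big)^{-1}-\mu^{-1}\mathrm{Id}.$$ *)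

theory Defs
  imports "HOL-Analysis.Analysis"
begin

text \<open>
  A set-valued mapping \<open>A : H \<rightrightarrows> H\<close> is a function \<open>'a \<Rightarrow> 'a set\<close>; values may be empty.
  \<open>+\<close> and \<open>\<Sum>\<close> on sets are the Minkowski operations of \<open>HOL-Library.Set_Algebras\<close>.
\<close>

type_synonym 'a setmap = "'a \<Rightarrow> 'a set"

definition graph_of :: "'a setmap \<Rightarrow> ('a \<times> 'a) set"
  where "graph_of A = {(x, u). u \<in> A x}"

definition monotone_map :: "('a::real_inner) setmap \<Rightarrow> bool"
  where "monotone_map A \<longleftrightarrow> (\<forall>x y u v. u \<in> A x \<longrightarrow> v \<in> A y \<longrightarrow> 0 \<le> (u - v) \<bullet> (x - y))"

definition maximally_monotone :: "('a::real_inner) setmap \<Rightarrow> bool"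
  where "maximally_monotone A \<longleftrightarrow>
    monotone_map A \<and> (\<forall>B. monotone_map B \<longrightarrow> graph_of A \<subseteq> graph_of B \<longrightarrow> B = A)"

definition strictly_monotone :: "('a::real_inner) setmap \<Rightarrow> bool"
  where "strictly_monotone A \<longleftrightarrow>
    (\<forall>x y u v. u \<in> A x \<longrightarrow> v \<in> A y \<longrightarrow> x \<noteq> y \<longrightarrow> 0 < (u - v) \<bullet> (x - y))"

definition inverse_map :: "'a setmap \<Rightarrow> 'a setmap"
  where "inverse_map A = (\<lambda>u. {x. u \<in> A x})"

definition id_map :: "'a setmap"
  where "id_map = (\<lambda>x. {x})"

definition add_map :: "('a::plus) setmap \<Rightarrow> 'a setmap \<Rightarrow> 'a setmap"
  where "add_map A B = (\<lambda>x. A x + B x)"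

definition scale_map :: "real \<Rightarrow> ('a::real_vector) setmap \<Rightarrow> 'a setmap"
  where "scale_map c A = (\<lambda>x. (\<lambda>u. c *\<^sub>R u) ` A x)"

definition sum_map :: "('i \<Rightarrow> ('a::comm_monoid_add) setmap) \<Rightarrow> 'i set \<Rightarrow> 'a setmap"
  where "sum_map A I = (\<lambda>x. \<Sum>i\<in>I. A i x)"

text \<open>
  Since \<open>-\<close> on sets is set difference in HOL, subtracting \<open>\<mu>\<^sup>-\<^sup>1 Id\<close> is written
  as Minkowski addition of \<open>(- \<mu>\<^sup>-\<^sup>1) Id\<close>.
\<close>

definition resolvent_average ::
    "real \<Rightarrow> 'i set \<Rightarrow> ('i \<Rightarrow> ('a::real_vector) setmap) \<Rightarrow> ('i \<Rightarrow> real) \<Rightarrow> 'a setmap"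
  where "resolvent_average \<mu> I A l =
    add_map
      (inverse_map
        (sum_map
          (\<lambda>i. scale_map (l i) (inverse_map (add_map (A i) (scale_map (inverse \<mu>) id_map)))) I))
      (scale_map (- inverse \<mu>) id_map)"

end

theory Submission
  imports Defs
begin

text \<open>
  Put \<open>c = \<mu>\<^sup>-\<^sup>1\<close>. A pair \<open>(x, u)\<close> lies in the graph of the resolvent average exactly when
  \<open>x = \<Sum>i. \<lambda>\<^sub>i x\<^sub>i\<close> for some points \<open>x\<^sub>i\<close> with \<open>u + c (x - x\<^sub>i) \<in> A\<^sub>i x\<^sub>i\<close>
  (\<open>mem_resolvent_average_iff\<close>). Take a second pair \<open>(y, v)\<close> with points \<open>y\<^sub>i\<close>, and write
  \<open>w = u - v\<close>, \<open>d = x - y\<close>, \<open>d\<^sub>i = x\<^sub>i - y\<^sub>i\<close>, \<open>w\<^sub>i = w + c (d - d\<^sub>i)\<close>. Then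
  \<open>\<langle>w\<^sub>i, d\<^sub>i\<rangle> + c \<parallel>d\<^sub>i - d\<parallel>\<^sup>2 = \<langle>w, d\<^sub>i\<rangle> + c \<langle>d - d\<^sub>i, d\<rangle>\<close>,
  and averaging with the weights \<open>\<lambda>\<^sub>i\<close>, for which \<open>d = \<Sum>i. \<lambda>\<^sub>i d\<^sub>i\<close>, gives
  \<open>\<langle>w, d\<rangle> = \<Sum>i. \<lambda>\<^sub>i (\<langle>w\<^sub>i, d\<^sub>i\<rangle> + c \<parallel>d\<^sub>i - d\<parallel>\<^sup>2)\<close> (\<open>weighted_inner_identity\<close>).
  Here \<open>w\<^sub>i\<close> is the difference of the values \<open>u + c (x - x\<^sub>i)\<close> and \<open>v + c (y - y\<^sub>i)\<close> of \<open>A\<^sub>i\<close>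
  at \<open>x\<^sub>i\<close> and \<open>y\<^sub>i\<close>, so every summand is nonnegative because \<open>A\<^sub>i\<close> is monotone. Suppose \<open>d \<noteq> 0\<close>. Then the summand of a
  strictly monotone \<open>A\<^sub>i\<close> is positive: through its first term if \<open>d\<^sub>i \<noteq> 0\<close>, and through
  its second term if \<open>d\<^sub>i = 0\<close>.
\<close>

lemma mem_resolvent_average_iff:
  fixes A :: "'i \<Rightarrow> ('a::real_vector) setmap"
  assumes "finite I"
  shows "u \<in> resolvent_average \<mu> I A l x \<longleftrightarrow>
    (\<exists>p. x = (\<Sum>i\<in>I. l i *\<^sub>R p i) \<and> (\<forall>i\<in>I. u + inverse \<mu> *\<^sub>R (x - p i) \<in> A i (p i)))"
proof -
  define c where "c = inverse \<mu>"
  have shift: "z \<in> S + {b} \<longleftrightarrow> z - b \<in> S" for z b :: 'a and S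
    unfolding set_plus_def by (auto intro!: bexI[of _ "z - b"])
  have "u \<in> resolvent_average \<mu> I A l x \<longleftrightarrow>
      x \<in> (\<Sum>i\<in>I. (\<lambda>p. l i *\<^sub>R p) ` {p. u + c *\<^sub>R x - c *\<^sub>R p \<in> A i p})"
    by (simp add: resolvent_average_def add_map_def inverse_map_def sum_map_def scale_map_def
        id_map_def shift c_def)
  also have "\<dots> \<longleftrightarrow> (\<exists>s. x = sum s I \<and>
      (\<forall>i\<in>I. \<exists>p. s i = l i *\<^sub>R p \<and> u + c *\<^sub>R x - c *\<^sub>R p \<in> A i p))"
    unfolding set_sum_alt[OF assms] by (simp only: image_iff mem_Collect_eq Bex_def conj_commute)
  also have "\<dots> \<longleftrightarrow> (\<exists>p. x = (\<Sum>i\<in>I. l i *\<^sub>R p i) \<and>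
      (\<forall>i\<in>I. u + c *\<^sub>R x - c *\<^sub>R p i \<in> A i (p i)))" (is "?L \<longleftrightarrow> ?M")
  proof
    assume ?L
    then obtain s p where "x = sum s I"
      and p: "\<forall>i\<in>I. s i = l i *\<^sub>R p i \<and> u + c *\<^sub>R x - c *\<^sub>R p i \<in> A i (p i)"
      unfolding bchoice_iff by blast
    then have "x = (\<Sum>i\<in>I. l i *\<^sub>R p i)"
      by simp
    with p show ?M by blast
  next
    assume ?M
    then show ?L by blast
  qed
  finally show ?thesis
    by (simp add: c_def scaleR_diff_right add_diff_eq)
qed

lemma weighted_inner_identity:
  fixes w d :: "'a::real_inner" and e :: "'i \<Rightarrow> 'a"
  assumes "sum l I = 1" and "d = (\<Sum>i\<in>I. l i *\<^sub>R e i)"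
  shows "w \<bullet> d = (\<Sum>i\<in>I. l i * ((w + c *\<^sub>R (d - e i)) \<bullet> e i + c * (norm (e i - d))\<^sup>2))"
proof -
  have term_eq: "(w + c *\<^sub>R (d - e i)) \<bullet> e i + c * (norm (e i - d))\<^sup>2
      = w \<bullet> e i + c * (d \<bullet> d) - c * (d \<bullet> e i)" for i
    unfolding power2_norm_eq_inner by (simp add: inner_simps algebra_simps inner_commute)
  have avg: "z \<bullet> d = (\<Sum>i\<in>I. l i * (z \<bullet> e i))" for z
    by (simp add: assms(2) inner_sum_right)
  have "(\<Sum>i\<in>I. l i * (w \<bullet> e i + c * (d \<bullet> d) - c * (d \<bullet> e i)))
      = (\<Sum>i\<in>I. l i * (w \<bullet> e i)) + sum l I * (c * (d \<bullet> d)) - c * (\<Sum>i\<in>I. l i * (d \<bullet> e i))"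
    by (simp add: sum.distrib sum_subtractf sum_distrib_left sum_distrib_right algebra_simps)
  also have "\<dots> = w \<bullet> d"
    by (simp add: assms(1) flip: avg)
  finally show ?thesis
    by (simp add: term_eq)
qed

theorem strictly_monotone_resolvent_average:
  fixes A :: "'i \<Rightarrow> ('a::real_inner) setmap"
  assumes "\<mu> > 0" and "finite I"
    and l_nonneg: "\<And>i. i \<in> I \<Longrightarrow> 0 \<le> l i" and "sum l I = 1"
    and mono: "\<And>i. i \<in> I \<Longrightarrow> monotone_map (A i)"
    and j: "j \<in> I" "0 < l j" "strictly_monotone (A j)"
  shows "strictly_monotone (resolvent_average \<mu> I A l)"
  unfolding strictly_monotone_def
proof (intro allI impI)
  fix x y u v
  assume "u \<in> resolvent_average \<mu> I A l x" "v \<in> resolvent_average \<mu> I A l y" and "x \<noteq> y"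
  define c where "c = inverse \<mu>"
  have "c > 0"
    using \<open>\<mu> > 0\<close> by (simp add: c_def)
  obtain p where p: "x = (\<Sum>i\<in>I. l i *\<^sub>R p i)" "\<And>i. i \<in> I \<Longrightarrow> u + c *\<^sub>R (x - p i) \<in> A i (p i)"
    using \<open>u \<in> _\<close> unfolding mem_resolvent_average_iff[OF \<open>finite I\<close>] c_def by blast
  obtain q where q: "y = (\<Sum>i\<in>I. l i *\<^sub>R q i)" "\<And>i. i \<in> I \<Longrightarrow> v + c *\<^sub>R (y - q i) \<in> A i (q i)"
    using \<open>v \<in> _\<close> unfolding mem_resolvent_average_iff[OF \<open>finite I\<close>] c_def by blast
  define d where "d = x - y"
  define e where "e i = p i - q i" for i
  define g where "g i = ((u - v) + c *\<^sub>R (d - e i)) \<bullet> e i" for i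
  have d_avg: "d = (\<Sum>i\<in>I. l i *\<^sub>R e i)"
    by (simp add: d_def e_def p(1) q(1) scaleR_diff_right sum_subtractf)
  have g_eq: "g i = ((u + c *\<^sub>R (x - p i)) - (v + c *\<^sub>R (y - q i))) \<bullet> (p i - q i)" for i
    unfolding g_def d_def e_def by (simp add: algebra_simps)
  have g_nonneg: "0 \<le> g i" if "i \<in> I" for i
    using mono[OF that] p(2)[OF that] q(2)[OF that] unfolding g_eq monotone_map_def by blast
  have g_pos: "0 < g j" if "e j \<noteq> 0"
    using j(3) p(2)[OF j(1)] q(2)[OF j(1)] that
    unfolding g_eq strictly_monotone_def e_def by auto
  have "0 < g j + c * (norm (e j - d))\<^sup>2"
  proof (cases "e j = 0")
    case True
    then show ?thesis
      using \<open>x \<noteq> y\<close> \<open>c > 0\<close> g_nonneg[OF j(1)] by (simp add: d_def add_nonneg_pos)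
  next
    case False
    then show ?thesis
      using g_pos \<open>c > 0\<close> by (simp add: add_pos_nonneg)
  qed
  then have "0 < (\<Sum>i\<in>I. l i * (g i + c * (norm (e i - d))\<^sup>2))"
    using \<open>finite I\<close> j(1,2) l_nonneg g_nonneg \<open>c > 0\<close> by (intro sum_pos2[of I j]) auto
  then show "0 < (u - v) \<bullet> (x - y)"
    using weighted_inner_identity[OF \<open>sum l I = 1\<close> d_avg, of "u - v" c]
    by (simp add: g_def d_def)
qed

theorem theorem3p7:
  fixes A :: "nat \<Rightarrow> ('a::{real_inner, complete_space}) setmap"
    and l :: "nat \<Rightarrow> real"
    and \<mu> :: real
    and n :: nat
  assumes "\<mu> > 0"
    and "n \<ge> 1"
    and "\<And>i. i \<in> {1..n} \<Longrightarrow> l i > 0"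
    and "(\<Sum>i\<in>{1..n}. l i) = 1"
    and "\<And>i. i \<in> {1..n} \<Longrightarrow> maximally_monotone (A i)"
    and "\<exists>i0\<in>{1..n}. strictly_monotone (A i0)"
  shows "strictly_monotone (resolvent_average \<mu> {1..n} A l)"
proof -
  obtain j where j: "j \<in> {1..n}" "strictly_monotone (A j)"
    using assms(6) by blast
  have mono: "monotone_map (A i)" if "i \<in> {1..n}" for i
    using assms(5)[OF that] by (simp add: maximally_monotone_def)
  show ?thesis
    using assms(1) _ _ assms(4) mono j(1) assms(3)[OF j(1)] j(2)
    by (rule strictly_monotone_resolvent_average) (use assms(3) less_imp_le in auto)
qed

end
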